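(* Let $\tilde{x}_k$ be the $k$-th iterate of the sketch-and-project method applied to the doubly noisy linear system $\widetilde{A}x=\tilde{b}$. Let $x_{LS}=A^{\dagger}b$ and $\tilde{x}_{LS}=\widetilde{A}^{\dagger}\tilde{b}$ be the least-squares solutions of the noiseless linear system $Ax=b$ and of the doubly noisy linear system $\widetilde{A}x=\tilde{b}$, respectively. Set $P_k=B^{-1}\widetilde{A}^{\top}H_k\widetilde{A}$ and $G=\mathbb{E}[P_k]$, where $H_k=S_k\left(S_k^{\top}\widetilde{A}B^{-1}\widetilde{A}^{\top}S_k\right)^{\dagger}S_k^{\top}$. Then for any initial point $\tilde{x}_0\in\mathbb{R}^n$ and any positive integer $k$, $$\begin{aligned}\|\mathbb{E}[\tilde{x}_k-x_{LS}]\|_B\le{}&(1-\lambda_r)^k\left\|(\tilde{x}_0-x_{LS})_{\mathcal{R}(G)}\right\|_B+\left\|(\tilde{x}_0-x_{LS})_{\mathcal{N}(G)}\right\|_B\\&+\left[1-(1-\lambda_1)^k\right]\left\|(\tilde{x}_{LS}-x_{LS})_{\mathcal{R}(G)}\right\|_B+\frac{\|B^{-1}\widetilde{A}^{\top}\mathbb{E}[H_k]\,\tilde{r}\|_B}{\lambda_r},\end{aligned}$$ where $\lambda_r$ and $\lambda_1$ are the smallest nonzero eigenvalue and the largest eigenvalue of the matrix $G$, respectively, and $\tilde{r}=\tilde{b}-\widetilde{A}\tilde{x}_{LS}$.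
   Context: $A,\widetilde{A}\in\mathbb{R}^{m\times n}$ and $b,\tilde{b}\in\mathbb{R}^m$ are fixed (deterministic); $\widetilde{A},\tilde{b}$ are noisy versions of $A,b$. Neither $Ax=b$ nor $\widetilde{A}x=\tilde{b}$ is assumed consistent. $M^{\dagger}$ is the Moore-Penrose inverse, $\mathcal{R}(\cdot)$ and $\mathcal{N}(\cdot)$ denote range and null space. $B\in\mathbb{R}^{n\times n}$ is a symmetric positive definite matrix, with inner product $\langle x,y\rangle_B=\langle Bx,y\rangle$ and norm $\|x\|_B=\sqrt{\langle x,x\rangle_B}$. Sketch-and-project method for $\widetilde{A}x=\tilde{b}$: random sketch matrices $S_k\in\mathbb{R}^{m\times q}$, $k=1,2,\dots$, are drawn independently and identically distributed, and starting from a deterministic $\tilde{x}_0$, $$\tilde{x}_k=\tilde{x}_{k-1}-B^{-1}\widetilde{A}^{\top}S_k\left(S_k^{\top}\widetilde{A}B^{-1}\widetilde{A}^{\top}S_k\right)^{\dagger}S_k^{\top}\left(\widetilde{A}\tilde{x}_{k-1}-\tilde{b}\right).$$ $\mathbb{E}$ denotes expectation over all sketch matrices; by identical distribution, $G$ and $\mathbb{E}[H_k]$ do not depend on $k$. It is assumed that $\mathbb{E}[H_k]$ exists and that $G\neq0$. The matrix $G$ is self-adjoint with respect to $\langle\cdot,\cdot\rangle_B$, so $\mathcal{R}(G)$ and $\mathcal{N}(G)$ are $B$-orthogonal complements; $(x)_{\mathcal{R}(G)}$ and $(x)_{\mathcal{N}(G)}$ denote the components of $x$ in the decomposition $\mathbb{R}^n=\mathcal{R}(G)\oplus\mathcal{N}(G)$,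 orthogonal with respect to the $B$-inner product. *)

theory Defs
  imports "HOL-Probability.Probability"
begin

(* The Penrose equations have exactly one solution for every real matrix A, so the
   description below is never degenerate. *)
definition pinv :: "real^'n^'m \<Rightarrow> real^'m^'n" where
  "pinv A = (THE X. A ** X ** A = A \<and> X ** A ** X = X
                  \<and> transpose (A ** X) = A ** X \<and> transpose (X ** A) = X ** A)"

definition sym_pos_def :: "real^'n^'n \<Rightarrow> bool" where
  "sym_pos_def B \<longleftrightarrow> transpose B = B \<and> (\<forall>x. x \<noteq> 0 \<longrightarrow> (B *v x) \<bullet> x > 0)"

definition norm_B :: "real^'n^'n \<Rightarrow> real^'n \<Rightarrow> real" where
  "norm_B B x = sqrt ((B *v x) \<bullet> x)"

(* Real eigenvalues. The matrix G this is applied to is self-adjoint for the B-inner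
   product, so it has no others. *)
definition eigenvalues :: "real^'n^'n \<Rightarrow> real set" where
  "eigenvalues G = {c. \<exists>v. v \<noteq> 0 \<and> G *v v = c *\<^sub>R v}"

definition range_space :: "real^'n^'m \<Rightarrow> (real^'m) set" where
  "range_space G = range ((*v) G)"

definition null_space :: "real^'n^'m \<Rightarrow> (real^'n) set" where
  "null_space G = {x. G *v x = 0}"

(* The component in U of x in the direct sum decomposition of the whole space into
   U and V; meaningful when every x is uniquely a sum of an element of U and one of V. *)
definition component_in :: "(real^'n) set \<Rightarrow> (real^'n) set \<Rightarrow> real^'n \<Rightarrow> real^'n" where
  "component_in U V x = (THE u. u \<in> U \<and> x - u \<in> V)"

definition range_comp :: "real^'n^'n \<Rightarrow> real^'n \<Rightarrow> real^'n" where
  "range_comp G x = component_in (range_space G) (null_space G) x"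

definition null_comp :: "real^'n^'n \<Rightarrow> real^'n \<Rightarrow> real^'n" where
  "null_comp G x = component_in (null_space G) (range_space G) x"

(* In the following At is the m-by-n matrix of the system being solved, bt its right-hand
   side, and the argument T (respectively S k \<omega>) is a value of the m-by-q sketch matrix. *)

definition sketch_H :: "real^'n^'n \<Rightarrow> real^'n^'m \<Rightarrow> real^'q^'m \<Rightarrow> real^'m^'m" where
  "sketch_H B At T =
     T ** pinv (transpose T ** At ** matrix_inv B ** transpose At ** T) ** transpose T"

definition sketch_P :: "real^'n^'n \<Rightarrow> real^'n^'m \<Rightarrow> real^'q^'m \<Rightarrow> real^'n^'n" where
  "sketch_P B At T = matrix_inv B ** transpose At ** sketch_H B At T ** At"

(* The sketch matrices are indexed from 1: step k + 1 uses S (k + 1), and S 0 is unused. *)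
primrec sketch_iter ::
  "real^'n^'n \<Rightarrow> real^'n^'m \<Rightarrow> real^'m \<Rightarrow> (nat \<Rightarrow> 'w \<Rightarrow> real^'q^'m) \<Rightarrow> real^'n
     \<Rightarrow> nat \<Rightarrow> 'w \<Rightarrow> real^'n" where
  "sketch_iter B At bt S x0 0 \<omega> = x0"
| "sketch_iter B At bt S x0 (Suc k) \<omega> =
     sketch_iter B At bt S x0 k \<omega>
     - (matrix_inv B ** transpose At ** S (Suc k) \<omega>
        ** pinv (transpose (S (Suc k) \<omega>) ** At ** matrix_inv B ** transpose At ** S (Suc k) \<omega>)
        ** transpose (S (Suc k) \<omega>))
       *v (At *v sketch_iter B At bt S x0 k \<omega> - bt)"

end

theory Submission
  imports Defs
begin

text \<open>
  Taking expectations turns the random iteration into a deterministic affine one. Every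
  \<open>sketch_P B At T\<close> is a projection, orthogonal for the \<open>B\<close>-inner product, and the iterate
  before step \<open>k + 1\<close> depends only on the earlier sketches, hence is independent of
  \<open>sketch_P B At (S (k + 1))\<close>. So the means \<open>m k\<close> of the iterates satisfy
  \<open>m (k + 1) = m k - G (m k - xt_LS) + z\<close> with \<open>z = B\<inverse> At\<^sup>T EH rt\<close>: subtracting the
  residual \<open>rt\<close> from the right-hand side makes \<open>xt_LS\<close> an exact solution, and the residual
  itself becomes a constant drift (\<open>sketch_iter_expectation\<close>).

  As an average of orthogonal projections, \<open>G\<close> is self-adjoint for the \<open>B\<close>-inner product with
  spectrum in \<open>[0, 1]\<close>, so the spectral theorem (\<open>self_adjoint_eigenbasis\<close>) provides a
  \<open>B\<close>-orthonormal basis of eigenvectors. In that basis the recursion splits into scalar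
  recursions, and for an eigenvalue \<open>\<mu>\<close> the coordinate of \<open>m k - x_LS\<close> is
  \<open>(1 - \<mu>)^k u + (1 - (1 - \<mu>)^k) w + (\<Sum>j<k. (1 - \<mu>)^j) y\<close>, where \<open>u\<close>, \<open>w\<close>, \<open>y\<close> are the
  coordinates of \<open>x0 - x_LS\<close>, \<open>xt_LS - x_LS\<close> and \<open>z\<close>. If \<open>\<mu> \<noteq> 0\<close>, the three factors are at
  most \<open>(1 - lam_r)^k\<close>, \<open>1 - (1 - lam_1)^k\<close> and \<open>1 / lam_r\<close>. If \<open>\<mu> = 0\<close>, the first factor is
  \<open>1\<close>, which gives the null-space term, the second is \<open>0\<close>, and the third is \<open>k\<close>; the
  bound holds because the drift \<open>z\<close> has no component in the null space of \<open>G\<close>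
  (\<open>expected_sketch\<close>). Parseval's identity and the triangle inequality then finish the
  proof (\<open>perturbed_iteration_bound\<close>).

  Using independence requires the sketching operators to be measurable functions of the sketch,
  so the pseudoinverse has to be Borel measurable although it is discontinuous. It is the
  pointwise limit of the Tikhonov regularizations \<open>(A\<^sup>T A + \<epsilon> I)\<inverse> A\<^sup>T\<close> as \<open>\<epsilon>\<close> tends to \<open>0\<close>,
  whose entries are rational functions of the entries of \<open>A\<close> by Cramer's rule
  (\<open>tikhonov_tendsto_pinv\<close>, \<open>borel_measurable_pinv\<close>).
\<close>

section \<open>The spectral theorem for a weighted inner product\<close>

abbreviation (input) inner_B :: "real^'n^'n \<Rightarrow> real^'n \<Rightarrow> real^'n \<Rightarrow> real" where
  "inner_B B x y \<equiv> (B *v x) \<bullet> y"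

lemma inner_B_commute:
  assumes "sym_pos_def B" shows "inner_B B x y = inner_B B y x"
proof -
  have "inner_B B x y = (transpose B *v x) \<bullet> y" using assms by (simp only: sym_pos_def_def)
  also have "\<dots> = x \<bullet> (B *v y)"
    by (simp add: dot_lmul_matrix)
  finally show ?thesis by (simp add: inner_commute)
qed

lemma inner_B_pos: "sym_pos_def B \<Longrightarrow> x \<noteq> 0 \<Longrightarrow> inner_B B x x > 0"
  by (auto simp: sym_pos_def_def)

lemma inner_B_nonneg: "sym_pos_def B \<Longrightarrow> inner_B B x x \<ge> 0"
  using inner_B_pos[of B x] by (cases "x = 0") auto

lemma inner_B_eq_0: "sym_pos_def B \<Longrightarrow> inner_B B x x = 0 \<Longrightarrow> x = 0"
  using inner_B_pos[of B x] by force

lemmas inner_B_linear = matrix_vector_right_distrib matrix_vector_mult_diff_distrib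
  matrix_vector_mult_scaleR inner_add_left inner_add_right inner_diff_left inner_diff_right

definition self_adjoint_for :: "real^'n^'n \<Rightarrow> real^'n^'n \<Rightarrow> bool" where
  "self_adjoint_for B G \<longleftrightarrow> (\<forall>x y. inner_B B (G *v x) y = inner_B B x (G *v y))"

text \<open>
  A maximizer of the Rayleigh quotient over the unit sphere of an invariant subspace is an
  eigenvector: with \<open>c\<close> the maximum, the form \<open>c \<langle>x, y\<rangle> - \<langle>G x, y\<rangle>\<close> is positive semidefinite
  on the subspace and vanishes at the maximizer, so the maximizer lies in its kernel.
\<close>

lemma self_adjoint_has_eigenvector:
  fixes B G :: "real^'n^'n"
  assumes B: "sym_pos_def B" and G: "self_adjoint_for B G"
    and V: "subspace V" "V \<noteq> {0}" "\<And>x. x \<in> V \<Longrightarrow> G *v x \<in> V"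
  obtains v c where "v \<in> V" "inner_B B v v = 1" "G *v v = c *\<^sub>R v"
proof -
  define q where "q x = inner_B B (G *v x) x / inner_B B x x" for x
  let ?K = "V \<inter> sphere 0 1"
  have "inner_B B x x \<noteq> 0" if "x \<in> ?K" for x
  proof -
    have "x \<noteq> 0" using that by auto
    from inner_B_pos[OF B this] show ?thesis by simp
  qed
  hence cont: "continuous_on ?K q"
    unfolding q_def
    by (intro continuous_intros bounded_linear.continuous_on[OF matrix_vector_mul_bounded_linear])
       blast
  have "compact ?K"
    using V(1) by (simp add: closed_Int_compact closed_subspace)
  moreover have "?K \<noteq> {}"
  proof -
    from V obtain x where "x \<in> V" "x \<noteq> 0" using subspace_0 by blast
    hence "(1 / norm x) *\<^sub>R x \<in> ?K" using V(1) by (auto intro: subspace_scale)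
    thus ?thesis by blast
  qed
  ultimately obtain w where w: "w \<in> ?K" "\<And>x. x \<in> ?K \<Longrightarrow> q x \<le> q w"
    using continuous_attains_sup[OF _ _ cont] by blast
  define c where "c = q w"
  define s where "s x y = c * inner_B B x y - inner_B B (G *v x) y" for x y
  have w0: "w \<noteq> 0" "w \<in> V" using w(1) by auto
  have s_sym: "s x y = s y x" for x y
  proof -
    have "inner_B B (G *v x) y = inner_B B (G *v y) x"
      using G inner_B_commute[OF B, of x "G *v y"] by (simp add: self_adjoint_for_def)
    thus ?thesis using inner_B_commute[OF B, of x y] by (simp add: s_def)
  qed
  have s_ww: "s w w = 0"
    using inner_B_pos[OF B w0(1)] by (simp add: s_def c_def q_def)
  have s_nonneg: "s x x \<ge> 0" if "x \<in> V" for x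
  proof (cases "x = 0")
    case False
    have "(1 / norm x) *\<^sub>R x \<in> ?K" using V(1) that False by (auto intro: subspace_scale)
    hence "q ((1 / norm x) *\<^sub>R x) \<le> c" using w(2) by (simp add: c_def)
    moreover have "q ((1 / norm x) *\<^sub>R x) = q x"
      using False by (simp add: q_def inner_B_linear)
    ultimately have "q x \<le> c" by simp
    thus ?thesis
      using inner_B_pos[OF B False] by (simp add: q_def s_def field_simps)
  qed (simp add: s_def)
  have s_expand: "s (w + t *\<^sub>R y) (w + t *\<^sub>R y) = 2 * t * s w y + t^2 * s y y" for t y
  proof -
    have "s (w + t *\<^sub>R y) (w + t *\<^sub>R y) = s w w + t * s w y + t * s y w + t^2 * s y y"
      by (simp add: s_def inner_B_linear power2_eq_square algebra_simps)
    thus ?thesis using s_sym[of y w] s_ww by simp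
  qed
  \<comment> \<open>The value \<open>2 t s(w, y) + t\<^sup>2 s(y, y)\<close> is nonnegative for all \<open>t\<close>. If \<open>s(w, y)\<close> were nonzero,
     a small \<open>t\<close> of the opposite sign would make it negative; adding \<open>1\<close> to \<open>s(y, y)\<close> in the
     denominator keeps the choice of \<open>t\<close> valid when \<open>s(y, y) = 0\<close>.\<close>
  have s_zero: "s w y = 0" if "y \<in> V" for y
  proof (rule ccontr)
    assume nz: "s w y \<noteq> 0"
    define h where "h = s y y"
    have h: "h \<ge> 0" using s_nonneg[OF that] by (simp add: h_def)
    define t where "t = - s w y / (h + 1)"
    have "w + t *\<^sub>R y \<in> V" using w0(2) that V(1) by (simp add: subspace_add subspace_scale)
    hence "0 \<le> 2 * t * s w y + t^2 * h"
      using s_nonneg s_expand h_def by metis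
    also have "\<dots> = (s w y)^2 * (h / (h+1)^2 - 2 / (h+1))"
      by (simp add: t_def power2_eq_square field_simps)
    also have "h / (h+1)^2 - 2 / (h+1) = - (h + 2) / (h+1)^2"
    proof -
      have "h + 1 \<noteq> 0" using h by linarith
      thus ?thesis by (simp add: divide_simps power2_eq_square)
    qed
    also have "(s w y)^2 * (- (h + 2) / (h+1)^2) < 0"
      using nz h by (intro mult_pos_neg) (auto simp: divide_simps)
    finally show False by simp
  qed
  define d where "d = c *\<^sub>R w - G *v w"
  have "d \<in> V" using V w0 by (simp add: d_def subspace_diff subspace_scale)
  moreover have "s w y = inner_B B d y" for y by (simp add: s_def d_def inner_B_linear)
  ultimately have "inner_B B d d = 0" using s_zero by metis
  hence "d = 0" by (rule inner_B_eq_0[OF B])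
  hence eig: "G *v w = c *\<^sub>R w" by (simp add: d_def)
  define v where "v = (1 / sqrt (inner_B B w w)) *\<^sub>R w"
  have pos: "inner_B B w w > 0" using inner_B_pos[OF B w0(1)] .
  have "inner_B B v v = inner_B B w w / (sqrt (inner_B B w w) * sqrt (inner_B B w w))" 
    by (simp add: v_def inner_B_linear)
  hence "inner_B B v v = 1" using pos by simp
  moreover have "v \<in> V" using w0(2) V(1) by (simp add: v_def subspace_scale)
  moreover have "G *v v = c *\<^sub>R v" by (simp add: v_def inner_B_linear eig)
  ultimately show thesis using that by blast
qed

text \<open>
  Induction on the dimension: the orthogonal complement of an eigenvector inside an invariant
  subspace is again invariant because \<open>G\<close> is self-adjoint.
\<close>

lemma self_adjoint_eigenbasis_subspace:
  fixes B G :: "real^'n^'n"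
  assumes B: "sym_pos_def B" and G: "self_adjoint_for B G"
    and "subspace V" "\<And>x. x \<in> V \<Longrightarrow> G *v x \<in> V"
  shows "\<exists>E \<mu>. finite E \<and> E \<subseteq> V \<and> (\<forall>e\<in>E. G *v e = \<mu> e *\<^sub>R e)
           \<and> (\<forall>e\<in>E. \<forall>f\<in>E. inner_B B e f = (if e = f then 1 else 0))
           \<and> (\<forall>x\<in>V. x = (\<Sum>e\<in>E. inner_B B x e *\<^sub>R e))"
  using assms(3,4)
proof (induction "dim V" arbitrary: V rule: less_induct)
  case less
  show ?case
  proof (cases "V = {0}")
    case True
    thus ?thesis by (intro exI[of _ "{}"]) auto
  next
    case False
    obtain v c where v: "v \<in> V" "inner_B B v v = 1" "G *v v = c *\<^sub>R v"
      using self_adjoint_has_eigenvector[OF B G less.prems(1) False less.prems(2)] by blast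
    define W where "W = {x \<in> V. inner_B B x v = 0}"
    have subW: "subspace W"
      using less.prems(1) unfolding W_def subspace_def by (auto simp: inner_B_linear)
    have "v \<notin> W" using v by (simp add: W_def)
    hence "W \<subset> V" using v(1) unfolding W_def by blast
    hence "span W \<subset> span V"
      using subW less.prems(1) by (simp add: span_eq_iff[THEN iffD2])
    hence "dim W < dim V" by (rule dim_psubset)
    moreover have "G *v x \<in> W" if "x \<in> W" for x
      using that less.prems(2) G v(3) by (simp add: W_def self_adjoint_for_def)
    ultimately obtain E \<mu> where E: "finite E" "E \<subseteq> W" "\<forall>e\<in>E. G *v e = \<mu> e *\<^sub>R e"
      "\<forall>e\<in>E. \<forall>f\<in>E. inner_B B e f = (if e = f then 1 else 0)"
      "\<forall>x\<in>W. x = (\<Sum>e\<in>E. inner_B B x e *\<^sub>R e)"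
      using less.hyps[of W] subW by blast
    have vE: "v \<notin> E" using E(2) \<open>v \<notin> W\<close> by blast
    have orth: "inner_B B e v = 0" "inner_B B v e = 0" if "e \<in> E" for e
      using that E(2) inner_B_commute[OF B, of v e] by (auto simp: W_def)
    have "x = (\<Sum>e\<in>insert v E. inner_B B x e *\<^sub>R e)" if "x \<in> V" for x
    proof -
      define y where "y = x - inner_B B x v *\<^sub>R v"
      have "y \<in> W" using that v less.prems(1)
        by (simp add: W_def y_def inner_B_linear subspace_diff subspace_scale)
      hence "y = (\<Sum>e\<in>E. inner_B B y e *\<^sub>R e)" using E(5) by blast
      also have "\<dots> = (\<Sum>e\<in>E. inner_B B x e *\<^sub>R e)"
        by (intro sum.cong) (auto simp: y_def inner_B_linear orth)
      finally show ?thesis using E(1) vE by (simp add: y_def algebra_simps)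
    qed
    moreover have "insert v E \<subseteq> V" using v(1) E(2) by (auto simp: W_def)
    moreover have "\<forall>e\<in>insert v E. G *v e = (\<mu>(v := c)) e *\<^sub>R e"
      using v(3) E(3) vE by auto
    moreover have "\<forall>e\<in>insert v E. \<forall>f\<in>insert v E. inner_B B e f = (if e = f then 1 else 0)"
      using v(2) E(4) orth vE by auto
    ultimately show ?thesis using E(1)
      by (intro exI[of _ "insert v E"] exI[of _ "\<mu>(v := c)"]) auto
  qed
qed

locale eigenbasis =
  fixes B G :: "real^'n^'n" and E :: "(real^'n) set" and \<mu> :: "real^'n \<Rightarrow> real"
  assumes B: "sym_pos_def B"
    and self_adjoint: "self_adjoint_for B G"
    and finite: "finite E"
    and eigenvector: "e \<in> E \<Longrightarrow> G *v e = \<mu> e *\<^sub>R e"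
    and orthonormal: "e \<in> E \<Longrightarrow> f \<in> E \<Longrightarrow> inner_B B e f = (if e = f then 1 else 0)"
    and expand: "x = (\<Sum>e\<in>E. inner_B B x e *\<^sub>R e)"

lemma self_adjoint_eigenbasis:
  assumes "sym_pos_def B" and "self_adjoint_for B G"
  obtains E \<mu> where "eigenbasis B G E \<mu>"
proof -
  obtain E \<mu> where "finite E" "\<forall>e\<in>E. G *v e = \<mu> e *\<^sub>R e"
    "\<forall>e\<in>E. \<forall>f\<in>E. inner_B B e f = (if e = f then 1 else 0)"
    "\<forall>x. x = (\<Sum>e\<in>E. inner_B B x e *\<^sub>R e)"
    using self_adjoint_eigenbasis_subspace[OF assms subspace_UNIV] by auto
  hence "eigenbasis B G E \<mu>"
    using assms by unfold_locales blast+
  thus thesis by (rule that)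
qed

context eigenbasis
begin

lemma nonzero: "e \<in> E \<Longrightarrow> e \<noteq> 0"
  using orthonormal[of e e] by auto

lemma coord_apply: "e \<in> E \<Longrightarrow> inner_B B (G *v x) e = \<mu> e * inner_B B x e"
  using self_adjoint eigenvector[of e] by (simp add: self_adjoint_for_def)

lemma coord_sum:
  assumes "e \<in> E" shows "inner_B B (\<Sum>f\<in>E. c f *\<^sub>R f) e = c e"
proof -
  have "inner_B B (\<Sum>f\<in>E. c f *\<^sub>R f) e = (\<Sum>f\<in>E. c f * inner_B B f e)"
    by (simp add: linear_sum[OF matrix_vector_mul_linear] inner_sum_left inner_B_linear)
  also have "\<dots> = (\<Sum>f\<in>E. if f = e then c f else 0)"
    using assms by (intro sum.cong) (auto simp: orthonormal)
  finally show ?thesis using assms finite by simp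
qed

lemma coord_eqI: "(\<And>e. e \<in> E \<Longrightarrow> inner_B B x e = inner_B B y e) \<Longrightarrow> x = y"
  using expand[of x] expand[of y] by simp

lemma norm_B_eq_L2_set: "norm_B B x = L2_set (inner_B B x) E"
proof -
  have "inner_B B x x = inner_B B x (\<Sum>e\<in>E. inner_B B x e *\<^sub>R e)" using expand[of x] by simp
  also have "\<dots> = (\<Sum>e\<in>E. (inner_B B x e)\<^sup>2)"
    by (simp add: inner_sum_right power2_eq_square)
  finally show ?thesis by (simp add: norm_B_def L2_set_def)
qed

lemma eigenvalues_eq: "eigenvalues G = \<mu> ` E"
proof
  show "\<mu> ` E \<subseteq> eigenvalues G"
    using nonzero eigenvector by (auto simp: eigenvalues_def)
  show "eigenvalues G \<subseteq> \<mu> ` E"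
  proof
    fix c assume "c \<in> eigenvalues G"
    then obtain v where v: "v \<noteq> 0" "G *v v = c *\<^sub>R v" by (auto simp: eigenvalues_def)
    then obtain e where e: "e \<in> E" "inner_B B v e \<noteq> 0"
      using coord_eqI[of v 0] by auto
    hence "c = \<mu> e" using coord_apply[OF e(1), of v] v(2) by (simp add: inner_B_linear)
    thus "c \<in> \<mu> ` E" using e(1) by blast
  qed
qed

lemma in_range_space_iff:
  "v \<in> range_space G \<longleftrightarrow> (\<forall>e\<in>E. \<mu> e = 0 \<longrightarrow> inner_B B v e = 0)"
proof
  assume "v \<in> range_space G"
  thus "\<forall>e\<in>E. \<mu> e = 0 \<longrightarrow> inner_B B v e = 0" by (auto simp: range_space_def coord_apply)
next
  assume *: "\<forall>e\<in>E. \<mu> e = 0 \<longrightarrow> inner_B B v e = 0"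
  have "v = G *v (\<Sum>e\<in>E. (inner_B B v e / \<mu> e) *\<^sub>R e)"
    by (rule coord_eqI) (use * in \<open>auto simp: coord_apply coord_sum\<close>)
  thus "v \<in> range_space G" by (auto simp: range_space_def)
qed

lemma in_null_space_iff:
  "v \<in> null_space G \<longleftrightarrow> (\<forall>e\<in>E. \<mu> e \<noteq> 0 \<longrightarrow> inner_B B v e = 0)"
proof -
  have "G *v v = 0 \<longleftrightarrow> (\<forall>e\<in>E. inner_B B (G *v v) e = inner_B B 0 e)"
    by (metis coord_eqI)
  thus ?thesis by (auto simp: null_space_def coord_apply)
qed

lemma coord_range_comp:
  assumes "e \<in> E"
  shows "inner_B B (range_comp G x) e = (if \<mu> e = 0 then 0 else inner_B B x e)"
proof -
  define c where "c e = (if \<mu> e = 0 then 0 else inner_B B x e)" for e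
  let ?u = "\<Sum>e\<in>E. c e *\<^sub>R e"
  have "range_comp G x = ?u"
    unfolding range_comp_def component_in_def
  proof (rule the_equality)
    show "?u \<in> range_space G \<and> x - ?u \<in> null_space G"
      by (auto simp: in_range_space_iff in_null_space_iff inner_B_linear coord_sum, auto simp: c_def)
    fix u assume "u \<in> range_space G \<and> x - u \<in> null_space G"
    thus "u = ?u"
      by (intro coord_eqI) (auto simp: in_range_space_iff in_null_space_iff inner_B_linear coord_sum c_def)
  qed
  thus ?thesis using assms by (simp add: coord_sum) (simp add: c_def)
qed

lemma coord_null_comp:
  assumes "e \<in> E"
  shows "inner_B B (null_comp G x) e = (if \<mu> e = 0 then inner_B B x e else 0)"
proof -
  define c where "c e = (if \<mu> e = 0 then inner_B B x e else 0)" for e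
  let ?u = "\<Sum>e\<in>E. c e *\<^sub>R e"
  have "null_comp G x = ?u"
    unfolding null_comp_def component_in_def
  proof (rule the_equality)
    show "?u \<in> null_space G \<and> x - ?u \<in> range_space G"
      by (auto simp: in_range_space_iff in_null_space_iff inner_B_linear coord_sum, auto simp: c_def)
    fix u assume "u \<in> null_space G \<and> x - u \<in> range_space G"
    thus "u = ?u"
      by (intro coord_eqI) (auto simp: in_range_space_iff in_null_space_iff inner_B_linear coord_sum c_def)
  qed
  thus ?thesis using assms by (simp add: coord_sum) (simp add: c_def)
qed

lemma norm_B_triangle: "norm_B B (x + y) \<le> norm_B B x + norm_B B y"
  using L2_set_triangle_ineq[of "inner_B B x" "inner_B B y" E]
  by (simp add: norm_B_eq_L2_set inner_B_linear cong: L2_set_cong)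

lemma norm_B_le_scaled:
  assumes "c \<ge> 0" "\<And>e. e \<in> E \<Longrightarrow> \<bar>inner_B B x e\<bar> \<le> c * \<bar>inner_B B y e\<bar>"
  shows "norm_B B x \<le> c * norm_B B y"
proof -
  have "norm_B B x = L2_set (\<lambda>e. \<bar>inner_B B x e\<bar>) E" by (simp add: norm_B_eq_L2_set L2_set_def)
  also have "\<dots> \<le> L2_set (\<lambda>e. c * \<bar>inner_B B y e\<bar>) E" using assms by (intro L2_set_mono) auto
  also have "\<dots> = c * norm_B B y"
    using assms(1) by (simp add: L2_set_right_distrib[symmetric] norm_B_eq_L2_set)
       (simp add: L2_set_def)
  finally show ?thesis .
qed


section \<open>The perturbed fixed-point iteration\<close>

lemma perturbed_iteration_coord:
  assumes step: "\<And>j. m (Suc j) = m j - G *v (m j - c) + z" and e: "e \<in> E"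
  shows "inner_B B (m k - l) e = (1 - \<mu> e) ^ k * inner_B B (m 0 - l) e
           + (1 - (1 - \<mu> e) ^ k) * inner_B B (c - l) e + (\<Sum>j<k. (1 - \<mu> e) ^ j) * inner_B B z e"
proof (induction k)
  case (Suc k)
  have sum_Suc: "(\<Sum>j<Suc k. (1 - \<mu> e) ^ j) = (1 - \<mu> e) * (\<Sum>j<k. (1 - \<mu> e) ^ j) + 1"
    by (subst sum.lessThan_Suc_shift) (simp add: sum_distrib_left)
  have "inner_B B (m (Suc k) - l) e
      = (1 - \<mu> e) * inner_B B (m k - l) e + \<mu> e * inner_B B (c - l) e + inner_B B z e"
    by (simp add: step inner_B_linear coord_apply[OF e, unfolded inner_B_linear] algebra_simps)
  moreover have "(1 - a) * (p * u + (1 - p) * v + s * w) + a * v + w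
      = (1 - a) * p * u + (1 - (1 - a) * p) * v + ((1 - a) * s + 1) * w" for a p u v s w :: real
    by (simp add: algebra_simps)
  ultimately show ?case by (simp only: Suc.IH sum_Suc power_Suc)
qed simp

text \<open>
  The hypothesis that \<open>z\<close> lies in the range of \<open>G\<close> is what keeps the drift bounded: along the
  null space nothing is contracted and the drift would accumulate linearly in \<open>k\<close>. On the range
  the geometric series of the factors \<open>1 - \<mu> e\<close> is bounded by \<open>1 / r\<close>.
\<close>

lemma perturbed_iteration_bound:
  assumes step: "\<And>j. m (Suc j) = m j - G *v (m j - c) + z"
    and z: "z \<in> range_space G" and "G \<noteq> 0"
    and contraction: "\<And>x. 0 \<le> inner_B B (G *v x) x" "\<And>x. inner_B B (G *v x) x \<le> inner_B B x x"
  defines "r \<equiv> Min (eigenvalues G - {0})" and "t \<equiv> Max (eigenvalues G)"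
  shows "norm_B B (m k - l) \<le> (1 - r) ^ k * norm_B B (range_comp G (m 0 - l))
           + norm_B B (null_comp G (m 0 - l))
           + (1 - (1 - t) ^ k) * norm_B B (range_comp G (c - l))
           + norm_B B z / r"
proof -
  have \<mu>01: "0 \<le> \<mu> e" "\<mu> e \<le> 1" if "e \<in> E" for e
    using contraction[of e] that by (simp_all add: eigenvector inner_B_linear orthonormal)
  have fin: "finite (eigenvalues G)" by (simp add: eigenvalues_eq finite)
  have "\<exists>e\<in>E. \<mu> e \<noteq> 0"
  proof (rule ccontr)
    assume "\<not> ?thesis"
    hence "G *v x = 0" for x by (intro coord_eqI) (simp add: coord_apply)
    hence "G = 0" by (simp add: matrix_eq)
    thus False using \<open>G \<noteq> 0\<close> by simp
  qed
  hence nonempty: "eigenvalues G - {0} \<noteq> {}" by (auto simp: eigenvalues_eq)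
  have "r \<in> eigenvalues G - {0}" unfolding r_def using fin nonempty by (intro Min_in) auto
  hence r: "0 < r" "r \<le> 1" using \<mu>01 by (force simp: eigenvalues_eq)+
  have r_le: "r \<le> \<mu> e" if "e \<in> E" "\<mu> e \<noteq> 0" for e
    unfolding r_def using fin that by (intro Min_le) (auto simp: eigenvalues_eq)
  have "t \<in> eigenvalues G" unfolding t_def using fin nonempty by (intro Max_in) auto
  hence t: "0 \<le> t" "t \<le> 1" using \<mu>01 by (auto simp: eigenvalues_eq)
  have t_ge: "\<mu> e \<le> t" if "e \<in> E" for e
    unfolding t_def using fin that by (intro Max_ge) (auto simp: eigenvalues_eq)
  \<comment> \<open>The contributions of the initial error, the shifted fixed point and the drift. Using the
     range components in \<open>v1\<close> leaves the initial error along the null space as a separate term.\<close>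
  define v1 where "v1 = (\<Sum>e\<in>E. ((1 - \<mu> e) ^ k * inner_B B (range_comp G (m 0 - l)) e) *\<^sub>R e)"
  define v3 where "v3 = (\<Sum>e\<in>E. ((1 - (1 - \<mu> e) ^ k) * inner_B B (range_comp G (c - l)) e) *\<^sub>R e)"
  define v4 where "v4 = (\<Sum>e\<in>E. ((\<Sum>j<k. (1 - \<mu> e) ^ j) * inner_B B z e) *\<^sub>R e)"
  have z0: "inner_B B z e = 0" if "e \<in> E" "\<mu> e = 0" for e
    using z that by (simp add: in_range_space_iff)
  have split: "m k - l = v1 + null_comp G (m 0 - l) + v3 + v4"
  proof (rule coord_eqI)
    fix e assume e: "e \<in> E"
    have "inner_B B (v1 + null_comp G (m 0 - l) + v3 + v4) e
        = inner_B B v1 e + inner_B B (null_comp G (m 0 - l)) e + inner_B B v3 e + inner_B B v4 e"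
      by (simp only: matrix_vector_right_distrib inner_add_left)
    also have "\<dots> = inner_B B (m k - l) e"
      using e z0[OF e] unfolding perturbed_iteration_coord[of m c z, OF step e, of k l] v1_def v3_def v4_def
      by (simp only: coord_sum coord_range_comp coord_null_comp) auto
    finally show "inner_B B (m k - l) e = inner_B B (v1 + null_comp G (m 0 - l) + v3 + v4) e" ..
  qed
  have n1: "norm_B B v1 \<le> (1 - r) ^ k * norm_B B (range_comp G (m 0 - l))"
  proof (rule norm_B_le_scaled)
    fix e assume e: "e \<in> E"
    show "\<bar>inner_B B v1 e\<bar> \<le> (1 - r) ^ k * \<bar>inner_B B (range_comp G (m 0 - l)) e\<bar>"
    proof (cases "\<mu> e = 0")
      case False
      thus ?thesis using e \<mu>01[OF e] r_le[OF e False]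
        by (auto simp: v1_def coord_sum abs_mult intro!: mult_right_mono power_mono)
    qed (use e in \<open>simp add: v1_def coord_sum coord_range_comp\<close>)
  qed (use r in simp)
  have n3: "norm_B B v3 \<le> (1 - (1 - t) ^ k) * norm_B B (range_comp G (c - l))"
  proof (rule norm_B_le_scaled)
    fix e assume e: "e \<in> E"
    have "(1 - t) ^ k \<le> (1 - \<mu> e) ^ k" "(1 - \<mu> e) ^ k \<le> 1"
      using \<mu>01[OF e] t_ge[OF e] t by (auto intro!: power_mono power_le_one)
    thus "\<bar>inner_B B v3 e\<bar> \<le> (1 - (1 - t) ^ k) * \<bar>inner_B B (range_comp G (c - l)) e\<bar>"
      using e by (auto simp: v3_def coord_sum abs_mult intro!: mult_right_mono)
  qed (use t in \<open>simp add: power_le_one\<close>)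
  have "norm_B B v4 \<le> 1 / r * norm_B B z"
  proof (rule norm_B_le_scaled)
    fix e assume e: "e \<in> E"
    show "\<bar>inner_B B v4 e\<bar> \<le> 1 / r * \<bar>inner_B B z e\<bar>"
    proof (cases "\<mu> e = 0")
      case False
      let ?s = "\<Sum>j<k. (1 - \<mu> e) ^ j"
      have s: "?s \<ge> 0" using \<mu>01[OF e] by (intro sum_nonneg) auto
      have "r * ?s \<le> \<mu> e * ?s" by (rule mult_right_mono[OF r_le[OF e False] s])
      also have "\<dots> = 1 - (1 - \<mu> e) ^ k" using one_diff_power_eq[of "1 - \<mu> e" k] by simp
      also have "\<dots> \<le> 1" using \<mu>01[OF e] by simp
      finally have "?s \<le> 1 / r" using r by (simp add: field_simps)
      hence "?s * \<bar>inner_B B z e\<bar> \<le> 1 / r * \<bar>inner_B B z e\<bar>" by (rule mult_right_mono) simp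
      thus ?thesis using e s by (simp add: v4_def coord_sum abs_mult)
    qed (use e z0 in \<open>simp add: v4_def coord_sum\<close>)
  qed (use r in simp)
  hence n4: "norm_B B v4 \<le> norm_B B z / r" by simp
  have "norm_B B (m k - l)
      \<le> norm_B B v1 + norm_B B (null_comp G (m 0 - l)) + norm_B B v3 + norm_B B v4"
    unfolding split
    using norm_B_triangle[of "v1 + null_comp G (m 0 - l) + v3" v4]
      norm_B_triangle[of "v1 + null_comp G (m 0 - l)" v3]
      norm_B_triangle[of v1 "null_comp G (m 0 - l)"]
    by linarith
  with n1 n3 n4 show ?thesis by linarith
qed

end

section \<open>The Moore-Penrose inverse\<close>

definition penrose :: "real^'n^'m \<Rightarrow> real^'m^'n \<Rightarrow> bool" where
  "penrose A X \<longleftrightarrow> A ** X ** A = A \<and> X ** A ** X = X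
                  \<and> transpose (A ** X) = A ** X \<and> transpose (X ** A) = X ** A"

lemma penroseD:
  assumes "penrose A X"
  shows "A ** X ** A = A" "X ** A ** X = X"
    "transpose X ** transpose A = A ** X" "transpose A ** transpose X = X ** A"
  using assms by (simp_all add: penrose_def matrix_transpose_mul)

text \<open>
  Both candidates coincide with the mixed product \<open>X ** A ** Y\<close>. The symmetry conditions
  allow a product \<open>A ** X\<close> to be transposed, so that \<open>A\<close> can be rewritten
  as \<open>A ** Y ** A\<close> inside it.
\<close>

lemma penrose_eq_product:
  assumes X: "penrose A X" and Y: "penrose A Y"
  shows "X = X ** A ** Y" "Y = X ** A ** Y"
proof -
  have "X = X ** (A ** X)" using penroseD(2)[OF X] by (simp add: matrix_mul_assoc)
  also have "\<dots> = X ** (transpose X ** transpose (A ** Y ** A))"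
    by (simp only: penroseD[OF X] penroseD[OF Y])
  also have "\<dots> = X ** (transpose X ** transpose A) ** (transpose Y ** transpose A)"
    by (simp only: matrix_transpose_mul matrix_mul_assoc)
  also have "\<dots> = X ** A ** X ** A ** Y"
    by (simp only: penroseD[OF X] penroseD[OF Y] matrix_mul_assoc)
  also have "\<dots> = X ** A ** Y"
    by (simp only: penroseD[OF X])
  finally show "X = X ** A ** Y" .
  have "Y = Y ** A ** Y" using penroseD(2)[OF Y] by simp
  also have "\<dots> = transpose (A ** X ** A) ** transpose Y ** Y"
    by (simp only: penroseD[OF X] penroseD[OF Y])
  also have "\<dots> = (transpose A ** transpose X) ** (transpose A ** transpose Y) ** Y"
    by (simp only: matrix_transpose_mul matrix_mul_assoc)
  also have "\<dots> = X ** A ** (Y ** A ** Y)"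
    by (simp only: penroseD(4)[OF X] penroseD(4)[OF Y] matrix_mul_assoc)
  also have "\<dots> = X ** A ** Y"
    by (simp only: penroseD(2)[OF Y])
  finally show "Y = X ** A ** Y" .
qed

lemma penrose_unique: "penrose A X \<Longrightarrow> penrose A Y \<Longrightarrow> X = Y"
  using penrose_eq_product[of A X Y] by simp

lemma symmetric_matrixI:
  fixes Z :: "real^'n^'n"
  assumes "\<And>x y. (Z *v x) \<bullet> y = x \<bullet> (Z *v y)"
  shows "transpose Z = Z"
proof -
  have "transpose Z *v x = Z *v x" for x
  proof (rule vector_eq_rdot[THEN iffD1], rule allI)
    fix y show "(transpose Z *v x) \<bullet> y = (Z *v x) \<bullet> y"
      using assms[of x y] by (simp add: dot_lmul_matrix)
  qed
  thus ?thesis by (subst matrix_eq) blast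
qed

text \<open>
  Diagonalize \<open>A\<^sup>T A\<close> with orthonormal eigenvectors \<open>e\<close> and eigenvalues \<open>\<mu> e\<close>. The vectors
  \<open>A e\<close> are pairwise orthogonal with squared norm \<open>\<mu> e\<close>, which is the singular value
  decomposition of \<open>A\<close>; inverting the nonzero singular values gives
  \<open>X y = (\<Sum>e. (A e \<bullet> y / \<mu> e) e)\<close>.
\<close>

lemma penrose_exists:
  fixes A :: "real^'n^'m"
  shows "\<exists>X. penrose A X"
proof -
  let ?C = "transpose A ** A"
  have inner_C: "(?C *v x) \<bullet> y = (A *v x) \<bullet> (A *v y)" for x y
    by (simp add: matrix_vector_mul_assoc[symmetric] dot_lmul_matrix)
  have "sym_pos_def (mat 1 :: real^'n^'n)" by (simp add: sym_pos_def_def)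
  moreover have "self_adjoint_for (mat 1) ?C"
    using inner_C by (simp add: self_adjoint_for_def inner_commute[of _ "?C *v _"]) (simp add: inner_commute)
  ultimately obtain E \<mu> where "eigenbasis (mat 1) ?C E \<mu>"
    by (rule self_adjoint_eigenbasis)
  then interpret eigenbasis "mat 1" ?C E \<mu> .
  note coord_sum' = coord_sum[simplified] and coord_eqI' = coord_eqI[simplified]
  define c where "c y e = (if \<mu> e = 0 then 0 else (A *v e) \<bullet> y / \<mu> e)" for y e
  define f where "f y = (\<Sum>e\<in>E. c y e *\<^sub>R e)" for y
  have "linear f"
    unfolding f_def c_def
    by (intro linear_compose_sum ballI linearI)
       (auto simp: inner_add_right add_divide_distrib scaleR_add_left)
  define X where "X = matrix f"
  have X: "X *v y = f y" for y using \<open>linear f\<close> by (simp add: X_def)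
  have coord_f: "f y \<bullet> e = c y e" if "e \<in> E" for y e
    using that by (simp add: f_def coord_sum')
  have inner_A: "(A *v e) \<bullet> (A *v x) = \<mu> e * (e \<bullet> x)" if "e \<in> E" for e x
    using inner_C[of e x] eigenvector[OF that] by simp
  have c_A: "c (A *v x) e = (if \<mu> e = 0 then 0 else x \<bullet> e)" if "e \<in> E" for x e
    using that by (simp add: c_def inner_A inner_commute)
  have A_kernel: "A *v e = 0" if "e \<in> E" "\<mu> e = 0" for e
    using inner_A[of e e] that by simp
  have AXA: "A *v f (A *v x) = A *v x" for x
  proof -
    have "A *v x = A *v (\<Sum>e\<in>E. (x \<bullet> e) *\<^sub>R e)" using expand[of x] by simp
    also have "\<dots> = A *v f (A *v x)"
      unfolding f_def linear_sum[OF matrix_vector_mul_linear] matrix_vector_mult_scaleR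
      by (intro sum.cong) (auto simp: c_A A_kernel)
    finally show ?thesis by simp
  qed
  have XAX: "f (A *v f y) = f y" for y
  proof (rule coord_eqI')
    fix e assume "e \<in> E"
    thus "f (A *v f y) \<bullet> e = f y \<bullet> e"
      using c_A[of e "f y"] by (simp add: coord_f) (simp add: c_def)
  qed
  have "transpose (A ** X) = A ** X"
  proof (rule symmetric_matrixI)
    fix x y
    show "((A ** X) *v x) \<bullet> y = x \<bullet> ((A ** X) *v y)"
      by (simp add: matrix_vector_mul_assoc[symmetric] X f_def linear_sum[OF matrix_vector_mul_linear]
          matrix_vector_mult_scaleR inner_sum_left inner_sum_right)
         (auto simp: c_def inner_commute intro!: sum.cong)
  qed
  moreover have "transpose (X ** A) = X ** A"
  proof (rule symmetric_matrixI)
    fix x y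
    have "f (A *v x) \<bullet> y = (\<Sum>e\<in>E. (if \<mu> e = 0 then 0 else x \<bullet> e) * (y \<bullet> e))" for x y
      by (simp add: f_def inner_sum_left c_A inner_commute[of y])
    hence "f (A *v x) \<bullet> y = f (A *v y) \<bullet> x"
      by (auto intro!: sum.cong)
    thus "((X ** A) *v x) \<bullet> y = x \<bullet> ((X ** A) *v y)"
      by (simp add: matrix_vector_mul_assoc[symmetric] X inner_commute)
  qed
  moreover have "A ** X ** A = A" "X ** A ** X = X"
    by (simp_all add: matrix_eq matrix_vector_mul_assoc[symmetric] X AXA XAX)
  ultimately show ?thesis by (auto simp: penrose_def)
qed

lemma penrose_pinv: "penrose A (pinv A)"
proof -
  have "\<exists>!X. penrose A X" using penrose_exists penrose_unique by blast
  from theI'[OF this] show ?thesis by (simp add: pinv_def penrose_def)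
qed

lemma transpose_pinv: 
  assumes "transpose A = A"
  shows "transpose (pinv A) = pinv A"
proof (rule penrose_unique[OF _ penrose_pinv])
  let ?X = "pinv A"
  note X = penrose_pinv[of A, unfolded penrose_def]
  have swap: "A ** transpose ?X = ?X ** A" "transpose ?X ** A = A ** ?X"
    using penroseD(3,4)[OF penrose_pinv[of A]] by (simp_all only: assms)
  have "A ** transpose ?X ** A = transpose (A ** ?X ** A)"
    "transpose ?X ** A ** transpose ?X = transpose (?X ** A ** ?X)"
    by (simp_all only: matrix_transpose_mul assms matrix_mul_assoc)
  hence "A ** transpose ?X ** A = A" "transpose ?X ** A ** transpose ?X = transpose ?X"
    using X by (simp_all only: assms)
  thus "penrose A (transpose ?X)"
    using X by (simp only: penrose_def swap simp_thms)
qed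

section \<open>Measurability of the Moore-Penrose inverse\<close>

definition tikhonov :: "real \<Rightarrow> real^'n^'m \<Rightarrow> real^'n^'n" where
  "tikhonov \<epsilon> A = transpose A ** A + \<epsilon> *\<^sub>R mat 1"

lemma tikhonov_coercive: "\<epsilon> * (x \<bullet> x) \<le> (tikhonov \<epsilon> A *v x) \<bullet> x"
  by (simp add: tikhonov_def matrix_vector_mult_add_rdistrib matrix_vector_mul_assoc[symmetric] inner_add_left
       dot_lmul_matrix scaleR_matrix_vector_assoc[symmetric])

lemma invertible_tikhonov:
  assumes "\<epsilon> > 0" shows "invertible (tikhonov \<epsilon> A)"
proof -
  have "x = 0" if "tikhonov \<epsilon> A *v x = 0" for x
  proof -
    have "\<epsilon> * (x \<bullet> x) \<le> 0" using tikhonov_coercive[of \<epsilon> x A] that by simp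
    thus ?thesis using assms inner_ge_zero[of x] by (simp add: mult_le_0_iff)
  qed
  thus ?thesis
    by (metis invertible_left_inverse matrix_left_invertible_ker)
qed

lemma matrix_inv_cancel:
  fixes A :: "real^'n^'n"
  assumes "invertible A" 
  shows "matrix_inv A ** A = mat 1" "A ** matrix_inv A = mat 1"
  using someI_ex[OF assms[unfolded invertible_def]] by (simp_all add: matrix_inv_def)

lemma norm_tikhonov_inv_le:
  assumes "\<epsilon> > 0"
  shows "\<epsilon> * norm (matrix_inv (tikhonov \<epsilon> A) *v y) \<le> norm y"
proof (cases "matrix_inv (tikhonov \<epsilon> A) *v y = 0")
  case False
  let ?w = "matrix_inv (tikhonov \<epsilon> A) *v y"
  have "tikhonov \<epsilon> A *v ?w = y"
    by (simp add: matrix_vector_mul_assoc matrix_inv_cancel invertible_tikhonov assms)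
  hence "\<epsilon> * (?w \<bullet> ?w) \<le> y \<bullet> ?w" using tikhonov_coercive[of \<epsilon> ?w A] by simp
  also have "\<dots> \<le> norm y * norm ?w" by (rule norm_cauchy_schwarz)
  finally have "norm ?w * (\<epsilon> * norm ?w) \<le> norm ?w * norm y"
    by (simp add: dot_square_norm power2_eq_square mult_ac)
  thus ?thesis using False by simp
qed simp

text \<open>
  Write \<open>X\<close> for the pseudoinverse and \<open>R\<close> for the inverse of \<open>A\<^sup>T A + \<epsilon> I\<close>. The normal
  equation \<open>A\<^sup>T A X = A\<^sup>T\<close> gives \<open>X - R A\<^sup>T = \<epsilon> R X\<close>. Since \<open>X\<close> maps into the range of
  \<open>A\<^sup>T A\<close>, namely \<open>X = A\<^sup>T A (X X\<^sup>T X)\<close>, and \<open>R A\<^sup>T A = I - \<epsilon> R\<close> is bounded uniformly in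
  \<open>\<epsilon>\<close>, the error is of order \<open>\<epsilon>\<close>.
\<close>

lemma tikhonov_error:
  fixes A :: "real^'n^'m"
  assumes "\<epsilon> > 0"
  shows "norm ((pinv A - matrix_inv (tikhonov \<epsilon> A) ** transpose A) *v y)
           \<le> \<epsilon> * (2 * norm ((pinv A ** transpose (pinv A) ** pinv A) *v y))"
proof -
  let ?X = "pinv A" and ?R = "matrix_inv (tikhonov \<epsilon> A)" and ?T = "transpose A"
  note X = penroseD[OF penrose_pinv[of A]]
  let ?z = "(?X ** transpose ?X ** ?X) *v y"
  have RD: "?R *v (tikhonov \<epsilon> A *v v) = v" for v
    by (simp add: matrix_vector_mul_assoc matrix_inv_cancel invertible_tikhonov assms)
  have D: "(?T ** A) *v v = tikhonov \<epsilon> A *v v - \<epsilon> *\<^sub>R v" for v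
    by (simp add: tikhonov_def matrix_vector_mult_add_rdistrib scaleR_matrix_vector_assoc[symmetric])
  have T: "?T ** A ** ?X = ?T"
  proof -
    have "?T ** A ** ?X = ?T ** (transpose ?X ** ?T)" by (simp only: X matrix_mul_assoc)
    also have "\<dots> = transpose (A ** ?X ** A)" by (simp only: matrix_transpose_mul matrix_mul_assoc)
    finally show ?thesis by (simp only: X)
  qed
  have "?T ** A ** (?X ** transpose ?X ** ?X) = ?T ** transpose ?X ** ?X"
    by (simp only: T matrix_mul_assoc)
  also have "\<dots> = ?X" by (simp only: X)
  finally have Xy: "?X *v y = (?T ** A) *v ?z" by (simp add: matrix_vector_mul_assoc matrix_mul_assoc)
  have "(?R ** ?T) *v y = ?R *v ((?T ** A) *v (?X *v y))"
    by (simp only: matrix_vector_mul_assoc matrix_mul_assoc[symmetric] T[unfolded matrix_mul_assoc[symmetric]])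
  also have "\<dots> = ?X *v y - \<epsilon> *\<^sub>R (?R *v (?X *v y))"
    by (simp only: D matrix_vector_mult_diff_distrib RD matrix_vector_mult_scaleR)
  finally have "(?X - ?R ** ?T) *v y = \<epsilon> *\<^sub>R (?R *v ((?T ** A) *v ?z))"
    by (simp add: matrix_vector_mult_diff_rdistrib Xy)
  also have "?R *v ((?T ** A) *v ?z) = ?z - \<epsilon> *\<^sub>R (?R *v ?z)"
    by (simp only: D matrix_vector_mult_diff_distrib RD matrix_vector_mult_scaleR)
  finally have "norm ((?X - ?R ** ?T) *v y) = \<epsilon> * norm (?z - \<epsilon> *\<^sub>R (?R *v ?z))"
    using assms by simp
  also have "norm (?z - \<epsilon> *\<^sub>R (?R *v ?z)) \<le> norm ?z + norm (\<epsilon> *\<^sub>R (?R *v ?z))"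
    by (rule norm_triangle_ineq4)
  also have "norm (\<epsilon> *\<^sub>R (?R *v ?z)) \<le> norm ?z"
    using norm_tikhonov_inv_le[OF assms, of A ?z] assms by simp
  finally show ?thesis using assms by simp
qed

lemma tikhonov_tendsto_pinv:
  fixes A :: "real^'n^'m"
  shows "(\<lambda>n. matrix_inv (tikhonov (1 / real (Suc n)) A) ** transpose A) \<longlonglongrightarrow> pinv A"
proof (intro vec_tendstoI)
  fix i j
  let ?F = "\<lambda>n. matrix_inv (tikhonov (1 / real (Suc n)) A) ** transpose A"
  let ?C = "2 * norm ((pinv A ** transpose (pinv A) ** pinv A) *v axis j 1)"
  have entry: "(Z *v axis j 1) $ i = Z $ i $ j" for Z :: "real^'m^'n"
    by (simp add: matrix_vector_mul_component inner_axis)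
  have "norm (pinv A $ i $ j - ?F n $ i $ j) \<le> (1 / real (Suc n)) * ?C" for n
  proof -
    have "norm (pinv A $ i $ j - ?F n $ i $ j) \<le> norm ((pinv A - ?F n) *v axis j 1)"
      using component_le_norm_cart[of "(pinv A - ?F n) *v axis j 1" i] by (simp add: entry)
    also have "\<dots> \<le> (1 / real (Suc n)) * ?C" by (rule tikhonov_error) simp
    finally show ?thesis .
  qed
  moreover have "(\<lambda>n. (1 / real (Suc n)) * ?C) \<longlonglongrightarrow> 0"
    using tendsto_mult_left_zero[OF LIMSEQ_Suc[OF lim_1_over_n]] .
  ultimately have "(\<lambda>n. pinv A $ i $ j - ?F n $ i $ j) \<longlonglongrightarrow> 0"
    by (rule Lim_null_comparison[OF always_eventually[OF allI]])
  from tendsto_diff[OF tendsto_const[of "pinv A $ i $ j"] this]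
  show "(\<lambda>n. ?F n $ i $ j) \<longlonglongrightarrow> pinv A $ i $ j" by simp
qed

lemma borel_measurable_vecI:
  fixes f :: "'a \<Rightarrow> 'b::euclidean_space^'n"
  assumes "\<And>i. (\<lambda>x. f x $ i) \<in> borel_measurable M"
  shows "f \<in> borel_measurable M"
  unfolding borel_measurable_euclidean_space[of f]
proof
  fix b :: "'b^'n" assume "b \<in> Basis"
  then obtain i u where "b = axis i u" by (auto simp: Basis_vec_def)
  thus "(\<lambda>x. f x \<bullet> b) \<in> borel_measurable M" using assms by (simp add: inner_axis)
qed

lemma borel_measurable_vec_nth [measurable (raw)]:
  fixes f :: "'a \<Rightarrow> 'b::euclidean_space^'n"
  assumes "f \<in> borel_measurable M"
  shows "(\<lambda>x. f x $ i) \<in> borel_measurable M"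
  using measurable_compose[OF assms borel_measurable_continuous_onI[OF linear_continuous_on[OF bounded_linear_vec_nth]]] .

lemma borel_measurable_matrixI:
  fixes f :: "'a \<Rightarrow> real^'n^'m"
  shows "(\<And>i j. (\<lambda>x. f x $ i $ j) \<in> borel_measurable M) \<Longrightarrow> f \<in> borel_measurable M"
  by (intro borel_measurable_vecI)

lemma borel_measurable_matrix_mult [measurable (raw)]:
  fixes f :: "'a \<Rightarrow> real^'n^'m" and g :: "'a \<Rightarrow> real^'p^'n"
  assumes [measurable]: "f \<in> borel_measurable M" "g \<in> borel_measurable M"
  shows "(\<lambda>x. f x ** g x) \<in> borel_measurable M"
  by (rule borel_measurable_matrixI) (simp add: matrix_matrix_mult_def)

lemma borel_measurable_matrix_vector_mult [measurable (raw)]: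
  fixes f :: "'a \<Rightarrow> real^'n^'m" and g :: "'a \<Rightarrow> real^'n"
  assumes [measurable]: "f \<in> borel_measurable M" "g \<in> borel_measurable M"
  shows "(\<lambda>x. f x *v g x) \<in> borel_measurable M"
  by (rule borel_measurable_vecI) (simp add: matrix_vector_mult_def)

lemma borel_measurable_transpose [measurable (raw)]:
  fixes f :: "'a \<Rightarrow> real^'n^'m"
  assumes [measurable]: "f \<in> borel_measurable M"
  shows "(\<lambda>x. transpose (f x)) \<in> borel_measurable M"
  by (rule borel_measurable_matrixI) (simp add: transpose_def)

lemma borel_measurable_det [measurable (raw)]:
  fixes f :: "'a \<Rightarrow> real^'n^'n"
  assumes [measurable]: "f \<in> borel_measurable M"
  shows "(\<lambda>x. det (f x)) \<in> borel_measurable M"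
  unfolding det_def by measurable

text \<open>
  Cramer's rule for the columns of the inverse. It expresses the entries through determinants,
  which are polynomials in the entries of the matrix and hence measurable.
\<close>

lemma matrix_inv_entry:
  fixes C :: "real^'n^'n"
  assumes "invertible C"
  shows "matrix_inv C $ k $ l =
    det (\<chi> i j. if j = k then (if i = l then 1 else 0) else C $ i $ j) / det C"
proof -
  have "C *v (matrix_inv C *v axis l 1) = axis l 1"
    by (simp add: matrix_vector_mul_assoc matrix_inv_cancel assms)
  hence "matrix_inv C *v axis l 1 = (\<chi> k. det (\<chi> i j. if j = k then axis l 1 $ i else C $ i $ j) / det C)"
    by (rule cramer[THEN iffD1, rotated]) (use assms in \<open>simp add: invertible_det_nz\<close>)
  moreover have "matrix_inv C $ k $ l = (matrix_inv C *v axis l 1) $ k"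
    by (simp add: matrix_vector_mul_component inner_axis)
  ultimately show ?thesis by (simp add: axis_def cong: if_cong)
qed

lemma borel_measurable_matrix_inv:
  fixes f :: "'a \<Rightarrow> real^'n^'n"
  assumes [measurable]: "f \<in> borel_measurable M" and inv: "\<And>x. invertible (f x)"
  shows "(\<lambda>x. matrix_inv (f x)) \<in> borel_measurable M"
proof (rule borel_measurable_matrixI)
  fix k l
  have "(\<lambda>x. (\<chi> i j. if j = k then (if i = l then 1 else 0) else f x $ i $ j) :: real^'n^'n)
          \<in> borel_measurable M"
    by (rule borel_measurable_matrixI) simp
  thus "(\<lambda>x. matrix_inv (f x) $ k $ l) \<in> borel_measurable M"
    unfolding matrix_inv_entry[OF inv] by measurable
qed

lemma borel_measurable_pinv [measurable (raw)]:
  fixes f :: "'a \<Rightarrow> real^'n^'m"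
  assumes [measurable]: "f \<in> borel_measurable M"
  shows "(\<lambda>x. pinv (f x)) \<in> borel_measurable M"
proof (rule borel_measurable_LIMSEQ_metric[OF _ tikhonov_tendsto_pinv])
  fix n
  have "(\<lambda>x. tikhonov (1 / real (Suc n)) (f x)) \<in> borel_measurable M"
    unfolding tikhonov_def by measurable
  hence [measurable]: "(\<lambda>x. matrix_inv (tikhonov (1 / real (Suc n)) (f x))) \<in> borel_measurable M"
    by (rule borel_measurable_matrix_inv) (simp add: invertible_tikhonov)
  show "(\<lambda>x. matrix_inv (tikhonov (1 / real (Suc n)) (f x)) ** transpose (f x)) \<in> borel_measurable M"
    by measurable
qed

section \<open>The sketching operators\<close>

lemma sym_pos_def_invertible:
  assumes "sym_pos_def B" shows "invertible B"
proof -
  have "x = 0" if "B *v x = 0" for x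
    using that by (intro inner_B_eq_0[OF assms]) simp
  thus ?thesis by (metis invertible_left_inverse matrix_left_invertible_ker)
qed

lemma inner_B_matrix_inv:
  assumes "sym_pos_def B" shows "inner_B B (matrix_inv B *v u) y = u \<bullet> y"
  by (simp add: matrix_vector_mul_assoc matrix_inv_cancel sym_pos_def_invertible assms)

lemma transpose_matrix_inv:
  assumes "sym_pos_def B" shows "transpose (matrix_inv B) = matrix_inv B"
proof (rule symmetric_matrixI)
  fix x y
  have "(matrix_inv B *v x) \<bullet> y = inner_B B (matrix_inv B *v y) (matrix_inv B *v x)"
    by (subst inner_B_matrix_inv[OF assms]) (rule inner_commute)
  also have "\<dots> = x \<bullet> (matrix_inv B *v y)"
    using assms by (simp only: inner_B_commute[OF assms, of "matrix_inv B *v y"] inner_B_matrix_inv)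
  finally show "(matrix_inv B *v x) \<bullet> y = x \<bullet> (matrix_inv B *v y)" .
qed

lemma symmetric_matrixD:
  fixes Z :: "real^'n^'n"
  assumes "transpose Z = Z" shows "(Z *v x) \<bullet> y = x \<bullet> (Z *v y)"
  using dot_lmul_matrix[of x Z y] assms by (metis transpose_matrix_vector)

text \<open>
  The symmetry of the pseudoinverse of a symmetric matrix carries over to \<open>sketch_H\<close>; it is the
  source of the self-adjointness of \<open>sketch_P\<close> and \<open>G\<close>.
\<close>

lemma transpose_sketch_H:
  assumes "sym_pos_def B" shows "transpose (sketch_H B At T) = sketch_H B At T"
proof -
  let ?C = "transpose T ** At ** matrix_inv B ** transpose At ** T"
  have "transpose ?C = ?C"
    by (simp add: matrix_transpose_mul transpose_matrix_inv[OF assms] matrix_mul_assoc)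
  from transpose_pinv[OF this] show ?thesis
    by (simp add: sketch_H_def matrix_transpose_mul matrix_mul_assoc)
qed

text \<open>
  This is the Penrose equation \<open>C\<^sup>+ C C\<^sup>+ = C\<^sup>+\<close> for \<open>C = T\<^sup>T At B\<inverse> At\<^sup>T T\<close>, and the
  reason why \<open>sketch_P\<close> is idempotent.
\<close>

lemma sketch_H_inner_inverse:
  "sketch_H B At T ** (At ** matrix_inv B ** transpose At) ** sketch_H B At T = sketch_H B At T"
proof -
  let ?C = "transpose T ** At ** matrix_inv B ** transpose At ** T"
  have "sketch_H B At T ** (At ** matrix_inv B ** transpose At) ** sketch_H B At T
      = T ** (pinv ?C ** ?C ** pinv ?C) ** transpose T"
    by (simp add: sketch_H_def matrix_mul_assoc)
  also have "\<dots> = sketch_H B At T"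
    by (simp only: penroseD(2)[OF penrose_pinv] sketch_H_def)
  finally show ?thesis .
qed

lemma inner_B_weighted:
  assumes "sym_pos_def B"
  shows "inner_B B ((matrix_inv B ** transpose At ** H ** At) *v x) y = (H *v (At *v x)) \<bullet> (At *v y)"
  by (simp add: matrix_vector_mul_assoc[symmetric] inner_B_matrix_inv assms dot_lmul_matrix)

lemma inner_B_sketch_P:
  assumes "sym_pos_def B"
  shows "inner_B B (sketch_P B At T *v x) y = (sketch_H B At T *v (At *v x)) \<bullet> (At *v y)"
  using inner_B_weighted[OF assms] by (simp only: sketch_P_def)

lemma sketch_H_sketch_P: "sketch_H B At T *v (At *v (sketch_P B At T *v x)) = sketch_H B At T *v (At *v x)"
proof -
  have "sketch_H B At T *v (At *v (sketch_P B At T *v x)) 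
      = (sketch_H B At T ** (At ** matrix_inv B ** transpose At) ** sketch_H B At T) *v (At *v x)"
    by (simp only: sketch_P_def matrix_vector_mul_assoc matrix_mul_assoc)
  thus ?thesis by (simp only: sketch_H_inner_inverse)
qed

text \<open>
  Self-adjointness and idempotence combined, which is the form needed to place the quadratic
  form of \<open>sketch_P\<close> between \<open>0\<close> and that of the identity.
\<close>

lemma sketch_P_projection:
  assumes "sym_pos_def B"
  shows "inner_B B (sketch_P B At T *v x) (sketch_P B At T *v x) = inner_B B (sketch_P B At T *v x) x"
proof -
  have "inner_B B (sketch_P B At T *v x) (sketch_P B At T *v x)
      = (At *v x) \<bullet> (sketch_H B At T *v (At *v (sketch_P B At T *v x)))"
    by (simp only: inner_B_sketch_P[OF assms] symmetric_matrixD[OF transpose_sketch_H[OF assms]])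
  also have "\<dots> = (At *v x) \<bullet> (sketch_H B At T *v (At *v x))"
    by (simp only: sketch_H_sketch_P)
  also have "\<dots> = inner_B B (sketch_P B At T *v x) x"
    by (subst inner_commute) (simp only: inner_B_sketch_P[OF assms])
  finally show ?thesis .
qed

lemma sketch_P_nonneg:
  assumes "sym_pos_def B"
  shows "0 \<le> inner_B B (sketch_P B At T *v x) x"
  using inner_B_nonneg[OF assms, of "sketch_P B At T *v x"] by (simp only: sketch_P_projection[OF assms])

lemma sketch_P_le:
  assumes "sym_pos_def B"
  shows "inner_B B (sketch_P B At T *v x) x \<le> inner_B B x x"
proof -
  let ?p = "sketch_P B At T *v x"
  have "0 \<le> inner_B B (x - ?p) (x - ?p)" by (rule inner_B_nonneg[OF assms])
  also have "\<dots> = inner_B B x x - inner_B B x ?p - inner_B B ?p x + inner_B B ?p ?p"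
    by (simp only: matrix_vector_mult_diff_distrib inner_diff_left inner_diff_right)
  also have "\<dots> = inner_B B x x - inner_B B ?p x"
    using sketch_P_projection[OF assms, of At T x] inner_B_commute[OF assms, of x ?p] by linarith
  finally show ?thesis by simp
qed

text \<open>
  The quadratic form at \<open>x\<close> is the squared \<open>B\<close>-norm of \<open>sketch_P B At T *v x\<close>, so \<open>x\<close> is
  annihilated by \<open>sketch_P\<close>; the point is that \<open>sketch_H *v (At *v x)\<close> then vanishes already
  before \<open>B\<inverse> At\<^sup>T\<close> is applied.
\<close>

lemma sketch_H_eq_0:
  assumes "sym_pos_def B" and "(sketch_H B At T *v (At *v x)) \<bullet> (At *v x) = 0"
  shows "sketch_H B At T *v (At *v x) = 0"
proof -
  have "sketch_P B At T *v x = 0"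
    using assms(2) by (intro inner_B_eq_0[OF assms(1)])
      (simp only: sketch_P_projection[OF assms(1)], simp only: inner_B_sketch_P[OF assms(1)])
  thus ?thesis using sketch_H_sketch_P[of B At T x] by simp
qed

section \<open>Expectation of the iterates\<close>

lemma borel_measurable_sketch_H [measurable (raw)]:
  assumes [measurable]: "f \<in> borel_measurable M"
  shows "(\<lambda>x. sketch_H B At (f x)) \<in> borel_measurable M"
  unfolding sketch_H_def by measurable

lemma sketch_iter_Suc:
  "sketch_iter B At bt S x0 (Suc k) \<omega> = sketch_iter B At bt S x0 k \<omega>
     - sketch_P B At (S (Suc k) \<omega>) *v sketch_iter B At bt S x0 k \<omega>
     + (matrix_inv B ** transpose At ** sketch_H B At (S (Suc k) \<omega>)) *v bt"
  by (simp add: sketch_P_def sketch_H_def matrix_mul_assoc matrix_vector_mult_diff_distrib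
      matrix_vector_mul_assoc)

lemma sketch_iter_0: "sketch_iter B At bt S x0 0 = (\<lambda>_. x0)"
  by (simp add: fun_eq_iff)

text \<open>
  The \<open>k\<close>-th iterate depends on the first \<open>k\<close> sketches only. The two sample spaces may differ, so
  the iterate can be transferred to the product space of the sketches themselves.
\<close>

lemma sketch_iter_cong:
  assumes "\<And>i. i \<in> {1..k} \<Longrightarrow> S i \<omega> = S' i \<omega>'"
  shows "sketch_iter B At bt S x0 k \<omega> = sketch_iter B At bt S' x0 k \<omega>'"
  using assms by (induction k) auto

lemma borel_measurable_sketch_iter:
  assumes "\<And>i. i \<in> {1..k} \<Longrightarrow> S i \<in> borel_measurable M"
  shows "sketch_iter B At bt S x0 k \<in> borel_measurable M"
  using assms
proof (induction k)
  case (Suc k)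
  have [measurable]: "S (Suc k) \<in> borel_measurable M" "sketch_iter B At bt S x0 k \<in> borel_measurable M"
    using Suc by auto
  show ?case unfolding sketch_iter_Suc[abs_def] sketch_P_def by measurable
qed (simp add: sketch_iter_0)

lemma integrable_vecI:
  fixes f :: "'a \<Rightarrow> real^'n"
  assumes "\<And>i. integrable M (\<lambda>x. f x $ i)"
  shows "integrable M f"
proof -
  have "f = (\<lambda>x. \<Sum>i\<in>UNIV. (f x $ i) *\<^sub>R axis i 1)"
    by (auto simp: fun_eq_iff vec_eq_iff axis_def if_distrib cong: if_cong)
  moreover have "integrable M (\<lambda>x. \<Sum>i\<in>UNIV. (f x $ i) *\<^sub>R (axis i 1 :: real^'n))"
    using assms by (intro Bochner_Integration.integrable_sum integrable_scaleR_left)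
  ultimately show ?thesis by simp
qed

lemma bounded_linear_matrix_mult_both:
  "bounded_linear (\<lambda>X :: real^'n^'m. (C :: real^'m^'p) ** X ** (D :: real^'q^'n))"
  unfolding linear_conv_bounded_linear[symmetric]
  by (rule linearI)
     (simp_all add: matrix_matrix_mult_def vec_eq_iff sum.distrib sum_distrib_left sum_distrib_right
        algebra_simps)

lemma bounded_linear_matrix_vector_left:
  "bounded_linear (\<lambda>X :: real^'n^'m. X *v v)"
  unfolding linear_conv_bounded_linear[symmetric]
  by (rule linearI) (simp_all add: matrix_vector_mult_add_rdistrib scaleR_matrix_vector_assoc)

text \<open>
  Independence is stated entrywise because \<open>indep_var\<close> relates random variables of one and the
  same type, which a matrix and a vector are not.
\<close>

lemma (in prob_space) indep_matrix_vector_mult: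
  fixes X :: "'a \<Rightarrow> real^'n^'m" and Y :: "'a \<Rightarrow> real^'n"
  assumes ind: "\<And>i j. indep_var borel (\<lambda>\<omega>. X \<omega> $ i $ j) borel (\<lambda>\<omega>. Y \<omega> $ j)"
    and X: "integrable M X" and Y: "integrable M Y"
  shows integrable_indep_matrix_vector_mult: "integrable M (\<lambda>\<omega>. X \<omega> *v Y \<omega>)"
    and expectation_indep_matrix_vector_mult:
      "(\<integral>\<omega>. X \<omega> *v Y \<omega> \<partial>M) = (\<integral>\<omega>. X \<omega> \<partial>M) *v (\<integral>\<omega>. Y \<omega> \<partial>M)"
proof -
  have X_entry: "bounded_linear (\<lambda>Z :: real^'n^'m. Z $ i $ j)" for i j
    by (rule bounded_linear_compose[of "\<lambda>y. y $ j" "\<lambda>Z. Z $ i"]) (rule bounded_linear_vec_nth)+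
  have iX: "integrable M (\<lambda>\<omega>. X \<omega> $ i $ j)" for i j
    by (rule integrable_bounded_linear[OF X_entry X])
  have iY: "integrable M (\<lambda>\<omega>. Y \<omega> $ j)" for j
    by (rule integrable_bounded_linear[OF bounded_linear_vec_nth Y])
  have comp: "integrable M (\<lambda>\<omega>. (X \<omega> *v Y \<omega>) $ i)" for i
    unfolding matrix_vector_mult_def
    using indep_var_integrable[OF ind iX iY] by simp
  show int: "integrable M (\<lambda>\<omega>. X \<omega> *v Y \<omega>)" by (rule integrable_vecI[OF comp])
  have "(\<integral>\<omega>. X \<omega> *v Y \<omega> \<partial>M) $ i = ((\<integral>\<omega>. X \<omega> \<partial>M) *v (\<integral>\<omega>. Y \<omega> \<partial>M)) $ i" for i
  proof -
    have "(\<integral>\<omega>. X \<omega> *v Y \<omega> \<partial>M) $ i = (\<integral>\<omega>. (X \<omega> *v Y \<omega>) $ i \<partial>M)"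
      by (rule integral_bounded_linear[OF bounded_linear_vec_nth int, symmetric])
    also have "\<dots> = (\<Sum>j\<in>UNIV. \<integral>\<omega>. X \<omega> $ i $ j * Y \<omega> $ j \<partial>M)"
      unfolding matrix_vector_mult_def
      using indep_var_integrable[OF ind iX iY] by simp
    also have "\<dots> = (\<Sum>j\<in>UNIV. (\<integral>\<omega>. X \<omega> \<partial>M) $ i $ j * (\<integral>\<omega>. Y \<omega> \<partial>M) $ j)"
      by (simp add: indep_var_lebesgue_integral[OF ind iX iY]
          integral_bounded_linear[OF X_entry X] integral_bounded_linear[OF bounded_linear_vec_nth Y])
    finally show ?thesis by (simp add: matrix_vector_mult_def)
  qed
  thus "(\<integral>\<omega>. X \<omega> *v Y \<omega> \<partial>M) = (\<integral>\<omega>. X \<omega> \<partial>M) *v (\<integral>\<omega>. Y \<omega> \<partial>M)"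
    by (simp add: vec_eq_iff)
qed

text \<open>
  The iterate is a measurable function of the block \<open>S 1, ..., S k\<close>, evaluated by running the same
  recursion with the coordinate functions as sketches, and this block is independent
  of \<open>S (k + 1)\<close>.
\<close>

lemma (in prob_space) indep_var_sketch_iter:
  fixes S :: "nat \<Rightarrow> 'a \<Rightarrow> real^'q^'m"
  assumes "indep_vars (\<lambda>_. borel) S {1..}"
  shows "indep_var borel (\<lambda>\<omega>. sketch_P B At (S (Suc k) \<omega>) $ i $ j)
                   borel (\<lambda>\<omega>. sketch_iter B At bt S x0 k \<omega> $ l)"
proof -
  let ?PiM = "\<lambda>I :: nat set. PiM I (\<lambda>_. borel :: (real^'q^'m) measure)"
  let ?f = "\<lambda>s. sketch_P B At (s (Suc k)) $ i $ j"
  let ?g = "\<lambda>s. sketch_iter B At bt (\<lambda>i s. s i) x0 k s $ l"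
  have "indep_var (?PiM {Suc k}) (\<lambda>\<omega>. restrict (\<lambda>i. S i \<omega>) {Suc k})
                  (?PiM {1..k}) (\<lambda>\<omega>. restrict (\<lambda>i. S i \<omega>) {1..k})"
    by (rule indep_var_restrict[OF assms]) auto
  moreover have "?f \<in> borel_measurable (?PiM {Suc k})"
    unfolding sketch_P_def by measurable
  moreover have "?g \<in> borel_measurable (?PiM {1..k})"
    by (intro borel_measurable_vec_nth borel_measurable_sketch_iter) measurable
  ultimately have "indep_var borel (?f \<circ> (\<lambda>\<omega>. restrict (\<lambda>i. S i \<omega>) {Suc k}))
                             borel (?g \<circ> (\<lambda>\<omega>. restrict (\<lambda>i. S i \<omega>) {1..k}))"
    by (rule indep_var_compose)
  moreover have "?g \<circ> (\<lambda>\<omega>. restrict (\<lambda>i. S i \<omega>) {1..k}) = (\<lambda>\<omega>. sketch_iter B At bt S x0 k \<omega> $ l)"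
    unfolding fun_eq_iff comp_def by (intro allI arg_cong[where f = "\<lambda>x. x $ l"] sketch_iter_cong) simp
  ultimately show ?thesis by (simp add: comp_def)
qed

lemma (in prob_space) sketch_iter_expectation:
  assumes indep: "indep_vars (\<lambda>_. borel) S {1..}"
    and H: "\<And>i. i \<ge> 1 \<Longrightarrow> integrable M (\<lambda>\<omega>. sketch_H B At (S i \<omega>))"
    and EH: "\<And>i. i \<ge> 1 \<Longrightarrow> (\<integral>\<omega>. sketch_H B At (S i \<omega>) \<partial>M) = EH"
  shows integrable_sketch_iter: "integrable M (sketch_iter B At bt S x0 k)"
    and expectation_sketch_iter_Suc:
      "(\<integral>\<omega>. sketch_iter B At bt S x0 (Suc k) \<omega> \<partial>M) = (\<integral>\<omega>. sketch_iter B At bt S x0 k \<omega> \<partial>M)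
         - (matrix_inv B ** transpose At ** EH ** At) *v (\<integral>\<omega>. sketch_iter B At bt S x0 k \<omega> \<partial>M)
         + (matrix_inv B ** transpose At ** EH) *v bt"
proof -
  have P: "integrable M (\<lambda>\<omega>. sketch_P B At (S (Suc k) \<omega>))"
    "(\<integral>\<omega>. sketch_P B At (S (Suc k) \<omega>) \<partial>M) = matrix_inv B ** transpose At ** EH ** At" for k
    using integrable_bounded_linear[OF bounded_linear_matrix_mult_both H[of "Suc k"]]
      integral_bounded_linear[OF bounded_linear_matrix_mult_both H[of "Suc k"]]
    by (simp_all add: sketch_P_def EH)
  have lin: "bounded_linear (\<lambda>X :: real^'c^'c. (matrix_inv B ** transpose At ** X) *v bt)"
    using bounded_linear_compose[of "\<lambda>Y. Y *v bt" "\<lambda>X. (matrix_inv B ** transpose At) ** X ** mat 1",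
        OF bounded_linear_matrix_vector_left bounded_linear_matrix_mult_both] by simp
  have Q: "integrable M (\<lambda>\<omega>. (matrix_inv B ** transpose At ** sketch_H B At (S (Suc k) \<omega>)) *v bt)"
    "(\<integral>\<omega>. (matrix_inv B ** transpose At ** sketch_H B At (S (Suc k) \<omega>)) *v bt \<partial>M)
       = (matrix_inv B ** transpose At ** EH) *v bt" for k
    using integrable_bounded_linear[OF lin H[of "Suc k"]] integral_bounded_linear[OF lin H[of "Suc k"]]
    by (simp_all add: EH)
  note step = integrable_indep_matrix_vector_mult[OF indep_var_sketch_iter[OF indep] P(1)]
    expectation_indep_matrix_vector_mult[OF indep_var_sketch_iter[OF indep] P(1)]
  show int: "integrable M (sketch_iter B At bt S x0 k)" for k
  proof (induction k)
    case (Suc k)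
    show ?case unfolding sketch_iter_Suc[abs_def]
      using Suc step(1)[OF Suc] Q(1) by simp
  qed (simp add: sketch_iter_0)
  show "(\<integral>\<omega>. sketch_iter B At bt S x0 (Suc k) \<omega> \<partial>M) = (\<integral>\<omega>. sketch_iter B At bt S x0 k \<omega> \<partial>M)
         - (matrix_inv B ** transpose At ** EH ** At) *v (\<integral>\<omega>. sketch_iter B At bt S x0 k \<omega> \<partial>M)
         + (matrix_inv B ** transpose At ** EH) *v bt"
    unfolding sketch_iter_Suc
    using int step(1)[OF int] Q(1) by (simp add: step(2)[OF int] P(2) Q(2))
qed

text \<open>
  The average \<open>G\<close> inherits its properties from the projections pointwise. The last claim uses
  that the range of \<open>G\<close> is the orthogonal complement of its null space: if \<open>G x = 0\<close>, then the
  nonnegative quadratic form of \<open>sketch_P\<close> at \<open>x\<close> has mean zero and vanishes almost surely, so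
  \<open>sketch_H *v (At *v x)\<close> vanishes almost surely and \<open>EH *v (At *v x) = 0\<close>. By the symmetry of
  \<open>EH\<close>, every vector \<open>B\<inverse> At\<^sup>T EH y\<close> is orthogonal to such an \<open>x\<close>.
\<close>

lemma (in prob_space) expected_sketch:
  assumes B: "sym_pos_def B"
    and H: "integrable M (\<lambda>\<omega>. sketch_H B At (T \<omega>))"
  defines "EH \<equiv> \<integral>\<omega>. sketch_H B At (T \<omega>) \<partial>M"
  defines "G \<equiv> matrix_inv B ** transpose At ** EH ** At"
  shows self_adjoint_expected_sketch: "self_adjoint_for B G"
    and expected_sketch_nonneg: "0 \<le> inner_B B (G *v x) x"
    and expected_sketch_le: "inner_B B (G *v x) x \<le> inner_B B x x"
    and expected_sketch_in_range: "(matrix_inv B ** transpose At ** EH) *v y \<in> range_space G"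
proof -
  have lin: "bounded_linear (\<lambda>X :: real^'c^'c. (X *v u) \<bullet> v)" for u v
    by (rule bounded_linear_compose[of "\<lambda>y. y \<bullet> v" "\<lambda>X. X *v u"])
       (rule bounded_linear_inner_left bounded_linear_matrix_vector_left)+
  have intH: "integrable M (\<lambda>\<omega>. (sketch_H B At (T \<omega>) *v u) \<bullet> v)" for u v
    by (rule integrable_bounded_linear[OF lin H])
  have EH: "(EH *v u) \<bullet> v = (\<integral>\<omega>. (sketch_H B At (T \<omega>) *v u) \<bullet> v \<partial>M)" for u v
    unfolding EH_def by (rule integral_bounded_linear[OF lin H, symmetric])
  have EH_sym: "(EH *v u) \<bullet> v = u \<bullet> (EH *v v)" for u v
  proof -
    have "(sketch_H B At (T \<omega>) *v u) \<bullet> v = (sketch_H B At (T \<omega>) *v v) \<bullet> u" for \<omega>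
      by (subst symmetric_matrixD[OF transpose_sketch_H[OF B]]) (rule inner_commute)
    hence "(EH *v u) \<bullet> v = (EH *v v) \<bullet> u" by (simp only: EH)
    thus ?thesis by (simp only: inner_commute)
  qed
  have G: "inner_B B (G *v x) y = (EH *v (At *v x)) \<bullet> (At *v y)" for x y
    unfolding G_def by (rule inner_B_weighted[OF B])
  have EP: "inner_B B (G *v x) y = (\<integral>\<omega>. inner_B B (sketch_P B At (T \<omega>) *v x) y \<partial>M)" for x y
    by (simp only: G EH inner_B_sketch_P[OF B])
  show sa: "self_adjoint_for B G"
    unfolding self_adjoint_for_def
  proof (intro allI)
    fix x y
    have "inner_B B (G *v x) y = (EH *v (At *v y)) \<bullet> (At *v x)"
      unfolding G by (subst EH_sym) (rule inner_commute)
    also have "\<dots> = inner_B B x (G *v y)"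
      unfolding G[symmetric] by (rule inner_B_commute[OF B])
    finally show "inner_B B (G *v x) y = inner_B B x (G *v y)" .
  qed
  show "0 \<le> inner_B B (G *v x) x"
    unfolding EP by (rule Bochner_Integration.integral_nonneg) (rule sketch_P_nonneg[OF B])
  have intP: "integrable M (\<lambda>\<omega>. inner_B B (sketch_P B At (T \<omega>) *v x) y)" for x y
    unfolding inner_B_sketch_P[OF B] by (rule intH)
  have "inner_B B (G *v x) x \<le> (\<integral>\<omega>. inner_B B x x \<partial>M)"
    unfolding EP by (rule integral_mono[OF intP]) (simp_all add: sketch_P_le[OF B])
  thus "inner_B B (G *v x) x \<le> inner_B B x x" by (simp add: prob_space)
  have kernel: "EH *v (At *v x) = 0" if "G *v x = 0" for x
  proof -
    have "(\<integral>\<omega>. inner_B B (sketch_P B At (T \<omega>) *v x) x \<partial>M) = 0"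
      using EP[of x x] that by simp
    hence "AE \<omega> in M. inner_B B (sketch_P B At (T \<omega>) *v x) x = 0"
      using integral_nonneg_eq_0_iff_AE[OF intP[of x x] AE_I2[OF sketch_P_nonneg[OF B]]] by blast
    hence ae: "AE \<omega> in M. sketch_H B At (T \<omega>) *v (At *v x) = 0"
      by eventually_elim (simp add: inner_B_sketch_P[OF B] sketch_H_eq_0[OF B])
    have "(EH *v (At *v x)) \<bullet> v = 0" for v
    proof -
      have "AE \<omega> in M. (sketch_H B At (T \<omega>) *v (At *v x)) \<bullet> v = 0"
        using ae by eventually_elim simp
      thus ?thesis unfolding EH by (rule integral_eq_zero_AE)
    qed
    thus ?thesis by (metis inner_eq_zero_iff)
  qed
  obtain E \<mu> where "eigenbasis B G E \<mu>" using self_adjoint_eigenbasis[OF B sa] .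
  then interpret eigenbasis B G E \<mu> .
  show "(matrix_inv B ** transpose At ** EH) *v y \<in> range_space G"
    unfolding in_range_space_iff
  proof (intro ballI impI)
    fix e assume "e \<in> E" "\<mu> e = 0"
    hence "EH *v (At *v e) = 0" using eigenvector[of e] by (intro kernel) simp
    thus "inner_B B ((matrix_inv B ** transpose At ** EH) *v y) e = 0"
      by (simp add: matrix_vector_mul_assoc[symmetric] inner_B_matrix_inv[OF B] dot_lmul_matrix EH_sym)
  qed
qed

section \<open>The error bound for the mean iterate\<close>

theorem theorem5p4:
  fixes M :: "'w measure"
    and S :: "nat \<Rightarrow> 'w \<Rightarrow> real^'q^'m"
    and A At :: "real^'n^'m"
    and b bt :: "real^'m"
    and B G :: "real^'n^'n"
    and EH :: "real^'m^'m"
    and x0 x_LS xt_LS :: "real^'n"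
    and rt :: "real^'m"
    and lam_r lam_1 :: real
    and k :: nat
  assumes "prob_space M"
    and S_indep: "prob_space.indep_vars M (\<lambda>_. borel) S {1..}"
    and S_ident: "\<And>i j. i \<ge> 1 \<Longrightarrow> j \<ge> 1 \<Longrightarrow> distr M borel (S i) = distr M borel (S j)"
    and B_spd: "sym_pos_def B"
    and k_pos: "k \<ge> 1"
    and H_integrable: "\<And>i. i \<ge> 1 \<Longrightarrow> integrable M (\<lambda>\<omega>. sketch_H B At (S i \<omega>))"
    and EH_eq: "EH = (\<integral>\<omega>. sketch_H B At (S k \<omega>) \<partial>M)"
    and G_eq: "G = (\<integral>\<omega>. sketch_P B At (S k \<omega>) \<partial>M)"
    and G_nonzero: "G \<noteq> 0"
    and x_LS_eq: "x_LS = pinv A *v b"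
    and xt_LS_eq: "xt_LS = pinv At *v bt"
    and rt_eq: "rt = bt - At *v xt_LS"
    and lam_r_eq: "lam_r = Min (eigenvalues G - {0})"
    and lam_1_eq: "lam_1 = Max (eigenvalues G)"
  shows "norm_B B (\<integral>\<omega>. (sketch_iter B At bt S x0 k \<omega> - x_LS) \<partial>M)
         \<le> (1 - lam_r) ^ k * norm_B B (range_comp G (x0 - x_LS))
           + norm_B B (null_comp G (x0 - x_LS))
           + (1 - (1 - lam_1) ^ k) * norm_B B (range_comp G (xt_LS - x_LS))
           + norm_B B ((matrix_inv B ** transpose At ** EH) *v rt) / lam_r"
proof -
  interpret prob_space M by fact
  \<comment> \<open>Identical distribution yields one mean for all steps, by the measurability of \<open>sketch_H\<close>.\<close>
  have EH: "(\<integral>\<omega>. sketch_H B At (S i \<omega>) \<partial>M) = EH" if "i \<ge> 1" for i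
  proof -
    have S: "S j \<in> borel_measurable M" if "j \<ge> 1" for j
      using S_indep that by (auto simp: indep_vars_def)
    have "(\<integral>\<omega>. sketch_H B At (S j \<omega>) \<partial>M) = (\<integral>T. sketch_H B At T \<partial>distr M borel (S j))" if "j \<ge> 1" for j
      by (rule integral_distr[OF S[OF that], symmetric]) measurable
    thus ?thesis using that k_pos S_ident[OF that k_pos] by (simp add: EH_eq)
  qed
  let ?N = "matrix_inv B ** transpose At ** EH"
  have G: "G = ?N ** At"
    unfolding G_eq EH_eq sketch_P_def
    by (rule integral_bounded_linear[OF bounded_linear_matrix_mult_both H_integrable[OF k_pos]])
  note G_facts = expected_sketch[OF B_spd H_integrable[OF k_pos], folded EH_eq, folded G]
  define m where "m j = (\<integral>\<omega>. sketch_iter B At bt S x0 j \<omega> \<partial>M)" for j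
  have "m (Suc j) = m j - G *v (m j - xt_LS) + ?N *v rt" for j
  proof -
    have "m (Suc j) = m j - G *v m j + ?N *v bt"
      unfolding m_def G by (rule expectation_sketch_iter_Suc[OF S_indep H_integrable EH])
    thus ?thesis
      by (simp add: rt_eq G matrix_vector_mult_diff_distrib matrix_vector_mul_assoc)
  qed
  moreover obtain E \<mu> where "eigenbasis B G E \<mu>"
    using self_adjoint_eigenbasis[OF B_spd G_facts(1)] .
  ultimately have "norm_B B (m k - x_LS)
         \<le> (1 - lam_r) ^ k * norm_B B (range_comp G (m 0 - x_LS))
           + norm_B B (null_comp G (m 0 - x_LS))
           + (1 - (1 - lam_1) ^ k) * norm_B B (range_comp G (xt_LS - x_LS))
           + norm_B B (?N *v rt) / lam_r"
    unfolding lam_r_eq lam_1_eq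
    by (intro eigenbasis.perturbed_iteration_bound G_facts(2-4) G_nonzero)
  moreover have "m 0 = x0" by (simp add: m_def prob_space)
  moreover have "(\<integral>\<omega>. (sketch_iter B At bt S x0 k \<omega> - x_LS) \<partial>M) = m k - x_LS"
    using integrable_sketch_iter[OF S_indep H_integrable EH, of bt x0 k] by (simp add: m_def prob_space)
  ultimately show ?thesis by simp
qed

end
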